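(* Let $\mathcal{H}_A$ be a two-dimensional complex Hilbert space and $\mathcal{H}_B,\mathcal{H}_C$ finite-dimensional complex Hilbert spaces. For every pure state $|\psi\rangle\langle\psi|$ on $\mathcal{H}_A\otimes\mathcal{H}_B\otimes\mathcal{H}_C$, $$L_{A:CB}-L_{AC:B}\le L_{AB:C},$$ where $L_{A:CB}$, $L_{AC:B}$, $L_{AB:C}$ are the logarithmic negativities of the state with respect to the bipartitions $A|BC$, $AC|B$ and $AB|C$ respectively.
   Context: For a bipartite state $\rho_{XY}$ on $\mathcal{H}_X\otimes\mathcal{H}_Y$, the logarithmic negativity is $L_{X:Y}=\log_2\|\rho_{XY}^{T_X}\|_1=\log_2(2N_{X:Y}+1)$, where $\rho_{XY}^{T_X}$ is the partial transpose with respect to $X$, $\|\sigma\|_1=\mathrm{Tr}\sqrt{\sigma^\dagger\sigma}$ is the trace norm, and $N_{X:Y}=\frac{\|\rho_{XY}^{T_X}\|_1-1}{2}$ is the negativity. *)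

theory Defs
  imports "Jordan_Normal_Form.Jordan_Normal_Form"
begin

text \<open>Finite-dimensional complex Hilbert spaces are modelled as C^n with the
standard inner product; operators are complex n x n matrices.\<close>

definition adj :: "complex mat \<Rightarrow> complex mat" where
  "adj A = mat (dim_col A) (dim_row A) (\<lambda>(i,j). cnj (A $$ (j,i)))"

definition psd :: "nat \<Rightarrow> complex mat \<Rightarrow> bool" where
  "psd n M \<longleftrightarrow> M \<in> carrier_mat n n \<and> adj M = M \<and>
     (\<forall>v \<in> carrier_vec n. 0 \<le> Re (\<Sum>i<n. cnj (v $ i) * (mult_mat_vec M v) $ i))"

text \<open>Positive square root of a positive semidefinite matrix (unique).\<close>
definition psd_sqrt :: "complex mat \<Rightarrow> complex mat" where
  "psd_sqrt M = (THE S. psd (dim_row M) S \<and> S * S = M)"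

definition mtrace :: "complex mat \<Rightarrow> complex" where
  "mtrace A = (\<Sum>i<dim_row A. A $$ (i,i))"

definition trace_norm :: "complex mat \<Rightarrow> real" where
  "trace_norm s = Re (mtrace (psd_sqrt (adj s * s)))"

text \<open>Tripartite system A (dim 2), B (dim dB), C (dim dC); product basis
index (a,b,c) is encoded as a*dB*dC + b*dC + c.  Party 0 = A, 1 = B, 2 = C.\<close>
definition comp :: "nat \<Rightarrow> nat \<Rightarrow> nat \<Rightarrow> nat \<Rightarrow> nat" where
  "comp dB dC k i = (if k = 0 then i div (dB * dC)
                     else if k = 1 then (i div dC) mod dB else i mod dC)"

definition enc :: "nat \<Rightarrow> nat \<Rightarrow> (nat \<Rightarrow> nat) \<Rightarrow> nat" where
  "enc dB dC f = f 0 * dB * dC + f 1 * dC + f 2"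

definition ptrans :: "nat \<Rightarrow> nat \<Rightarrow> nat set \<Rightarrow> complex mat \<Rightarrow> complex mat" where
  "ptrans dB dC S \<rho> = mat (dim_row \<rho>) (dim_col \<rho>) (\<lambda>(i,j).
     \<rho> $$ (enc dB dC (\<lambda>k. if k \<in> S then comp dB dC k j else comp dB dC k i),
           enc dB dC (\<lambda>k. if k \<in> S then comp dB dC k i else comp dB dC k j)))"

definition log_neg :: "nat \<Rightarrow> nat \<Rightarrow> nat set \<Rightarrow> complex mat \<Rightarrow> real" where
  "log_neg dB dC X \<rho> = log 2 (trace_norm (ptrans dB dC X \<rho>))"

definition proj :: "complex vec \<Rightarrow> complex mat" where
  "proj \<psi> = mat (dim_vec \<psi>) (dim_vec \<psi>) (\<lambda>(i,j). \<psi> $ i * cnj (\<psi> $ j))"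

end

theory Submission
  imports
    Defs
    "HOL-Analysis.Inner_Product"
    "HOL-Analysis.L2_Norm"
    "HOL-Library.FuncSet"
    "Jordan_Normal_Form.Schur_Decomposition"
begin

text \<open>
  Across a bipartition, the partial transpose of a pure state with Schmidt coefficients \<open>s\<^sub>k\<close> has
  trace norm \<open>(\<Sum> s\<^sub>k)\<^sup>2\<close>. Since \<open>\<Sum> s\<^sub>k\<^sup>2 = 1\<close>, this is at least \<open>1 + C\<close>, where \<open>C = sqrt (2 (1 - P))\<close> is
  the concurrence and \<open>P = \<Sum> s\<^sub>k\<^sup>4\<close> the purity of the reduced state, with equality if there are at
  most two Schmidt coefficients, as for the qubit \<open>A\<close>. The linear entropy \<open>1 - P\<close> is subadditive
  because \<open>\<langle>\<psi> \<otimes> \<psi>| (1 - F\<^sub>B) (1 - F\<^sub>C) |\<psi> \<otimes> \<psi>\<rangle> \<ge> 0\<close> for the flips \<open>F\<^sub>B\<close>, \<open>F\<^sub>C\<close> exchanging the two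
  copies of \<open>B\<close>, respectively \<open>C\<close>. Hence \<open>C\<^sub>A \<le> C\<^sub>B + C\<^sub>C\<close>, so that
  \<open>1 + C\<^sub>A \<le> (1 + C\<^sub>B) (1 + C\<^sub>C)\<close>, which is the claim after taking logarithms.
\<close>

section \<open>Sesquilinear algebra over finite index sets\<close>

definition cinner_on :: "'a set \<Rightarrow> ('a \<Rightarrow> complex) \<Rightarrow> ('a \<Rightarrow> complex) \<Rightarrow> complex" where
  "cinner_on A u v = (\<Sum>x\<in>A. cnj (u x) * v x)"

definition mult_vec_on :: "'a set \<Rightarrow> ('b \<Rightarrow> 'a \<Rightarrow> complex) \<Rightarrow> ('a \<Rightarrow> complex) \<Rightarrow> 'b \<Rightarrow> complex" where
  "mult_vec_on A h u x = (\<Sum>y\<in>A. h x y * u y)"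

definition hermitian_on :: "'a set \<Rightarrow> ('a \<Rightarrow> 'a \<Rightarrow> complex) \<Rightarrow> bool" where
  "hermitian_on A h \<longleftrightarrow> (\<forall>x\<in>A. \<forall>y\<in>A. cnj (h x y) = h y x)"

definition orthonormal_on :: "'a set \<Rightarrow> 'k set \<Rightarrow> ('k \<Rightarrow> 'a \<Rightarrow> complex) \<Rightarrow> bool" where
  "orthonormal_on A K q \<longleftrightarrow> (\<forall>j\<in>K. \<forall>k\<in>K. cinner_on A (q j) (q k) = of_bool (j = k))"

definition dyad_sum ::
  "'k set \<Rightarrow> ('k \<Rightarrow> real) \<Rightarrow> ('k \<Rightarrow> 'a \<Rightarrow> complex) \<Rightarrow> ('k \<Rightarrow> 'b \<Rightarrow> complex) \<Rightarrow> 'a \<Rightarrow> 'b \<Rightarrow> complex" where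
  "dyad_sum K a e f x y = (\<Sum>k\<in>K. of_real (a k) * e k x * cnj (f k y))"

lemmas of_real_norm_power2 = complex_norm_square[unfolded of_real_power]

lemma hermitian_onD: "hermitian_on A h \<Longrightarrow> x \<in> A \<Longrightarrow> y \<in> A \<Longrightarrow> cnj (h x y) = h y x"
  by (simp add: hermitian_on_def)

lemma orthonormal_onD:
  "orthonormal_on A K q \<Longrightarrow> j \<in> K \<Longrightarrow> k \<in> K \<Longrightarrow> cinner_on A (q j) (q k) = of_bool (j = k)"
  by (simp add: orthonormal_on_def)

lemma cinner_on_cong:
  "(\<And>x. x \<in> A \<Longrightarrow> u x = u' x) \<Longrightarrow> (\<And>x. x \<in> A \<Longrightarrow> v x = v' x) \<Longrightarrow> cinner_on A u v = cinner_on A u' v'"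
  by (simp add: cinner_on_def)

lemma mult_vec_on_cong:
  "(\<And>y. y \<in> A \<Longrightarrow> h x y = h' x y) \<Longrightarrow> (\<And>y. y \<in> A \<Longrightarrow> u y = u' y) \<Longrightarrow>
    mult_vec_on A h u x = mult_vec_on A h' u' x"
  by (simp add: mult_vec_on_def)

lemma cnj_cinner_on: "cnj (cinner_on A u v) = cinner_on A v u"
  by (simp add: cinner_on_def mult.commute)

lemma cinner_on_add_right: "cinner_on A u (\<lambda>x. v x + w x) = cinner_on A u v + cinner_on A u w"
  by (simp add: cinner_on_def distrib_left sum.distrib)

lemma cinner_on_scale_right: "cinner_on A u (\<lambda>x. c * v x) = c * cinner_on A u v"
  by (simp add: cinner_on_def sum_distrib_left ac_simps)

lemma cinner_on_scale_left: "cinner_on A (\<lambda>x. c * u x) v = cnj c * cinner_on A u v"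
  by (simp add: cinner_on_def sum_distrib_left ac_simps)

lemma cinner_on_sum_right: "cinner_on A u (\<lambda>x. \<Sum>i\<in>I. v i x) = (\<Sum>i\<in>I. cinner_on A u (v i))"
  by (simp add: cinner_on_def sum_distrib_left sum.swap[of _ _ I])

lemma cinner_on_self: "cinner_on A u u = of_real (\<Sum>x\<in>A. (cmod (u x))\<^sup>2)"
  by (simp add: cinner_on_def of_real_norm_power2 mult.commute)

lemma mult_vec_on_scale: "mult_vec_on A h (\<lambda>x. c * u x) x = c * mult_vec_on A h u x"
  by (simp add: mult_vec_on_def sum_distrib_left ac_simps)

lemma cinner_on_mult_vec_on:
  "cinner_on A u (mult_vec_on B h v) = cinner_on B (mult_vec_on A (\<lambda>y x. cnj (h x y)) u) v"
  unfolding cinner_on_def mult_vec_on_def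
  by (simp add: sum_distrib_left sum_distrib_right sum.swap[of _ B] ac_simps)

lemma cinner_on_hermitian:
  assumes "hermitian_on A h"
  shows "cinner_on A u (mult_vec_on A h v) = cinner_on A (mult_vec_on A h u) v"
  unfolding cinner_on_mult_vec_on
  using assms by (intro cinner_on_cong) (simp_all add: mult_vec_on_def hermitian_onD)

lemma mult_vec_on_mult_vec_on:
  "mult_vec_on A g (mult_vec_on B h u) x = mult_vec_on B (\<lambda>x z. \<Sum>y\<in>A. g x y * h y z) u x"
  unfolding mult_vec_on_def
  by (simp add: sum_distrib_left sum_distrib_right sum.swap[of _ B] mult.assoc)

lemma cinner_on_hermitian_square:
  assumes "hermitian_on A h"
  shows "cinner_on A (mult_vec_on A h u) (mult_vec_on A h u) =
    cinner_on A u (mult_vec_on A (\<lambda>x z. \<Sum>y\<in>A. h x y * h y z) u)"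
  unfolding cinner_on_hermitian[OF assms, symmetric] mult_vec_on_mult_vec_on[abs_def] ..

lemma cnj_dyad_sum: "cnj (dyad_sum K a e f x y) = dyad_sum K a f e y x"
  by (simp add: dyad_sum_def ac_simps)

lemma mult_vec_on_dyad_sum:
  "mult_vec_on A (dyad_sum K a e f) u x = (\<Sum>k\<in>K. of_real (a k) * cinner_on A (f k) u * e k x)"
  unfolding mult_vec_on_def dyad_sum_def cinner_on_def
  by (simp add: sum_distrib_left sum_distrib_right sum.swap[of _ A] ac_simps)

lemma cinner_on_basis_sum:
  assumes "finite K" "orthonormal_on A K q" "k \<in> K"
  shows "cinner_on A (q k) (\<lambda>x. \<Sum>j\<in>K. c j * q j x) = c k"
proof -
  have "cinner_on A (q k) (\<lambda>x. \<Sum>j\<in>K. c j * q j x) = (\<Sum>j\<in>K. c j * of_bool (k = j))"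
    unfolding cinner_on_sum_right cinner_on_scale_right
    using assms by (intro sum.cong) (simp_all add: orthonormal_onD)
  then show ?thesis using assms by (simp add: of_bool_def if_distrib cong: if_cong)
qed

lemma mult_vec_on_dyad_sum_basis:
  assumes "finite K" "orthonormal_on A K f" "k \<in> K"
  shows "mult_vec_on A (dyad_sum K a e f) (f k) x = of_real (a k) * e k x"
proof -
  have "mult_vec_on A (dyad_sum K a e f) (f k) x = (\<Sum>j\<in>K. of_real (a j) * of_bool (j = k) * e j x)"
    unfolding mult_vec_on_dyad_sum using assms by (intro sum.cong) (simp_all add: orthonormal_onD)
  then show ?thesis using assms by (simp add: of_bool_def if_distrib if_distribR cong: if_cong)
qed

lemma dyad_sum_compose:
  assumes "finite K" "orthonormal_on A K f"
  shows "(\<Sum>z\<in>A. dyad_sum K a e f x z * dyad_sum K b f g z y) = dyad_sum K (\<lambda>k. a k * b k) e g x y"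
proof -
  define c where "c k = of_real (b k) * cnj (g k y)" for k
  have "(\<Sum>z\<in>A. dyad_sum K a e f x z * dyad_sum K b f g z y) =
      mult_vec_on A (dyad_sum K a e f) (\<lambda>z. \<Sum>k\<in>K. c k * f k z) x"
    by (simp add: mult_vec_on_def dyad_sum_def[of _ b] c_def ac_simps)
  also have "\<dots> = (\<Sum>k\<in>K. of_real (a k) * c k * e k x)"
    unfolding mult_vec_on_dyad_sum by (simp add: cinner_on_basis_sum[OF assms])
  also have "\<dots> = dyad_sum K (\<lambda>k. a k * b k) e g x y"
    by (simp add: dyad_sum_def c_def ac_simps)
  finally show ?thesis .
qed

lemma trace_dyad_sum:
  assumes "orthonormal_on A K e"
  shows "(\<Sum>x\<in>A. dyad_sum K a e e x x) = of_real (\<Sum>k\<in>K. a k)"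
proof -
  have "(\<Sum>x\<in>A. dyad_sum K a e e x x) = (\<Sum>k\<in>K. of_real (a k) * cinner_on A (e k) (e k))"
    unfolding dyad_sum_def cinner_on_def
    by (subst sum.swap) (simp add: sum_distrib_left ac_simps)
  then show ?thesis using assms by (simp add: orthonormal_onD)
qed

section \<open>Diagonalisation of Hermitian forms\<close>

lemma mtrace_mult_comm:
  assumes "A \<in> carrier_mat n m" "B \<in> carrier_mat m n"
  shows "mtrace (A * B) = mtrace (B * A)"
  using assms
  by (simp add: mtrace_def scalar_prod_def sum.swap[of _ "{0..<m}"] lessThan_atLeast0 mult.commute)

lemma mtrace_similar:
  assumes "similar_mat A B"
  shows "mtrace A = mtrace B"
proof -
  obtain n P Q
    where carrier: "A \<in> carrier_mat n n" "B \<in> carrier_mat n n"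
      "P \<in> carrier_mat n n" "Q \<in> carrier_mat n n"
    and inverse: "Q * P = 1\<^sub>m n" and conjugate: "A = P * B * Q"
    using similar_matD[OF assms] by auto
  have "mtrace A = mtrace (Q * (P * B))"
    unfolding conjugate using carrier by (intro mtrace_mult_comm[of _ n n]) auto
  also have "Q * (P * B) = (Q * P) * B"
    using carrier by (simp add: assoc_mult_mat[of _ n n _ n _ n])
  finally show ?thesis using carrier by (simp add: inverse)
qed

lemma upper_triangular_mult_diag:
  fixes A :: "'a :: comm_semiring_1 mat"
  assumes "A \<in> carrier_mat n n" "B \<in> carrier_mat n n" "upper_triangular A" "upper_triangular B"
    and "i < n"
  shows "(A * B) $$ (i, i) = A $$ (i, i) * B $$ (i, i)"
proof -
  have "A $$ (i, k) * B $$ (k, i) = 0" if "k < n" "k \<noteq> i" for k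
    using assms that
    by (cases "k < i") (auto dest: upper_triangularD[of _ k i] upper_triangularD[of _ i k])
  then have "(\<Sum>k<n. A $$ (i, k) * B $$ (k, i)) = A $$ (i, i) * B $$ (i, i)"
    using \<open>i < n\<close> by (subst sum.remove[of _ i]) auto
  then show ?thesis using assms by (simp add: scalar_prod_def lessThan_atLeast0)
qed

lemma mtrace_hermitian_square:
  assumes carrier: "H \<in> carrier_mat n n" and self_adjoint: "adj H = H"
  shows "mtrace (H * H) = of_real (\<Sum>i<n. \<Sum>j<n. (cmod (H $$ (i, j)))\<^sup>2)"
proof -
  have "cnj (H $$ (i, j)) = H $$ (j, i)" if "i < n" "j < n" for i j
    using carrier that by (subst (2) self_adjoint[symmetric]) (simp add: adj_def)
  then show ?thesis
    using carrier
    by (simp add: mtrace_def scalar_prod_def lessThan_atLeast0 of_real_norm_power2)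
qed

text \<open>The trace of \<open>H\<^sup>2\<close> is the squared Frobenius norm of \<open>H\<close> as well as the sum of the squared
  eigenvalues.\<close>
lemma hermitian_nonzero_eigenvalue:
  assumes carrier_H: "H \<in> carrier_mat n n" and self_adjoint: "adj H = H" and nonzero: "H \<noteq> 0\<^sub>m n n"
  obtains e where "eigenvalue H e" "e \<noteq> 0"
proof -
  obtain es where factorization: "char_poly H = (\<Prod>a\<leftarrow>es. [:- a, 1:])"
    using char_poly_factorized[OF carrier_H] by auto
  obtain B where carrier_B: "B \<in> carrier_mat n n" and triangular: "upper_triangular B"
    and similar: "similar_mat H B"
    using schur_decomposition_exists[OF carrier_H factorization] by auto
  have eigenvalue_diag: "eigenvalue H (B $$ (i, i))" if "i < n" for i
  proof -
    have "B $$ (i, i) \<in> set (diag_mat B)" using carrier_B that by (auto simp: diag_mat_def)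
    then show ?thesis
      unfolding eigenvalue_root_char_poly[OF carrier_H] char_poly_similar[OF similar]
        char_poly_upper_triangular[OF carrier_B triangular]
      by (rule linear_poly_root)
  qed
  have "\<exists>i<n. \<exists>j<n. H $$ (i, j) \<noteq> 0"
    using nonzero carrier_H by (metis eq_matI carrier_matD index_zero_mat)
  then have "mtrace (H * H) \<noteq> 0"
    unfolding mtrace_hermitian_square[OF carrier_H self_adjoint] of_real_eq_0_iff
    by (auto simp: sum_nonneg_eq_0_iff sum_nonneg)
  moreover have "similar_mat (H * H) (B * B)"
    using similar similar_mat_wit_pow[of H B _ _ 2] carrier_H carrier_B
    by (auto simp: similar_mat_def numeral_2_eq_2)
  ultimately have "(\<Sum>i<n. B $$ (i, i) * B $$ (i, i)) \<noteq> 0"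
    using mtrace_similar[of "H * H" "B * B"] carrier_B
    by (simp add: mtrace_def
        upper_triangular_mult_diag[OF carrier_B carrier_B triangular triangular]
        del: index_mult_mat(1))
  then obtain i where "i < n" "B $$ (i, i) \<noteq> 0"
    by (metis (no_types, lifting) lessThan_iff mult_zero_left sum.neutral)
  then show thesis using eigenvalue_diag that by blast
qed

lemma hermitian_on_eigenvalue_real:
  assumes "hermitian_on A h" "cinner_on A w w = 1"
    and eigen: "\<And>x. x \<in> A \<Longrightarrow> mult_vec_on A h w x = e * w x"
  shows "e \<in> \<real>"
proof -
  have "e = cinner_on A w (mult_vec_on A h w)"
    using eigen assms(2) by (simp add: cinner_on_scale_right cong: cinner_on_cong)
  also have "\<dots> = cinner_on A (mult_vec_on A h w) w"
    using assms(1) by (rule cinner_on_hermitian)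
  also have "\<dots> = cnj e"
    using eigen assms(2) by (simp add: cinner_on_scale_left cong: cinner_on_cong)
  finally show ?thesis by (simp add: Reals_cnj_iff)
qed

lemma cinner_on_normalize:
  assumes "finite A" "x \<in> A" "u x \<noteq> 0"
  obtains c :: complex where "cinner_on A (\<lambda>x. c * u x) (\<lambda>x. c * u x) = 1"
proof
  define s where "s = (\<Sum>x\<in>A. (cmod (u x))\<^sup>2)"
  have "s > 0"
    unfolding s_def using assms by (intro sum_pos2[of _ x]) auto
  then have "1 / sqrt s * (1 / sqrt s) * s = 1" by simp
  then have "complex_of_real (1 / sqrt s * (1 / sqrt s) * s) = 1" by (simp only: of_real_1)
  then show "cinner_on A (\<lambda>x. of_real (1 / sqrt s) * u x) (\<lambda>x. of_real (1 / sqrt s) * u x) = 1"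
    unfolding cinner_on_scale_left cinner_on_scale_right cinner_on_self s_def[symmetric]
    by (simp only: of_real_mult complex_cnj_complex_of_real mult.assoc)
qed

lemma hermitian_on_nonzero_eigenvalue:
  assumes finite_A: "finite A" and herm: "hermitian_on A h" and nonzero: "\<exists>x\<in>A. \<exists>y\<in>A. h x y \<noteq> 0"
  obtains e u where "e \<noteq> 0" "\<exists>x\<in>A. u x \<noteq> 0" "\<And>x. x \<in> A \<Longrightarrow> mult_vec_on A h u x = e * u x"
proof -
  define n where "n = card A"
  obtain f where bij: "bij_betw f {..<n} A"
    using ex_bij_betw_nat_finite[OF finite_A] by (auto simp: n_def lessThan_atLeast0)
  then obtain g where f_in: "\<And>i. i < n \<Longrightarrow> f i \<in> A" and g_f: "\<And>i. i < n \<Longrightarrow> g (f i) = i"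
    and f_g: "\<And>x. x \<in> A \<Longrightarrow> f (g x) = x" and g_less: "\<And>x. x \<in> A \<Longrightarrow> g x < n"
    unfolding bij_betw_iff_bijections by auto
  define H where "H = mat n n (\<lambda>(i, j). h (f i) (f j))"
  have carrier_H: "H \<in> carrier_mat n n" by (simp add: H_def)
  have "adj H = H"
    by (intro eq_matI) (auto simp: H_def adj_def f_in hermitian_onD[OF herm])
  moreover obtain x y where "x \<in> A" "y \<in> A" "h x y \<noteq> 0" using nonzero by auto
  then have "H \<noteq> 0\<^sub>m n n"
    by (auto simp: H_def f_g g_less dest!: arg_cong[where f = "\<lambda>M. M $$ (g x, g y)"])
  ultimately obtain e where "eigenvalue H e" and "e \<noteq> 0"
    using carrier_H hermitian_nonzero_eigenvalue by blast
  then obtain v where v: "v \<in> carrier_vec n" "v \<noteq> 0\<^sub>v n" "H *\<^sub>v v = e \<cdot>\<^sub>v v"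
    using carrier_H by (auto simp: eigenvalue_def eigenvector_def)
  have "mult_vec_on A h (\<lambda>x. v $ g x) x = e * v $ g x" if "x \<in> A" for x
  proof -
    have "mult_vec_on A h (\<lambda>x. v $ g x) x = (\<Sum>j<n. h x (f j) * v $ g (f j))"
      unfolding mult_vec_on_def by (rule sum.reindex_bij_betw[OF bij, symmetric])
    also have "\<dots> = (H *\<^sub>v v) $ g x"
      using v(1) that by (simp add: H_def scalar_prod_def g_f f_g g_less lessThan_atLeast0)
    finally show ?thesis using v that by (simp add: g_less)
  qed
  moreover obtain i where "i < n" "v $ i \<noteq> 0"
    using v(1,2) by (metis carrier_vecD eq_vecI index_zero_vec)
  then have "\<exists>x\<in>A. v $ g x \<noteq> 0" using f_in g_f by metis
  ultimately show thesis using \<open>e \<noteq> 0\<close> that[of e "\<lambda>x. v $ g x"] by simp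
qed

lemma hermitian_on_unit_eigenvector:
  assumes finite_A: "finite A" and herm: "hermitian_on A h" and nonzero: "\<exists>x\<in>A. \<exists>y\<in>A. h x y \<noteq> 0"
  obtains e :: real and w where "e \<noteq> 0" "cinner_on A w w = 1"
    "\<And>x. x \<in> A \<Longrightarrow> mult_vec_on A h w x = of_real e * w x"
proof -
  obtain e u where "e \<noteq> 0" and "\<exists>x\<in>A. u x \<noteq> 0"
    and eigen: "\<And>x. x \<in> A \<Longrightarrow> mult_vec_on A h u x = e * u x"
    by (rule hermitian_on_nonzero_eigenvalue[OF assms]) blast
  from \<open>\<exists>x\<in>A. u x \<noteq> 0\<close> obtain c where unit: "cinner_on A (\<lambda>x. c * u x) (\<lambda>x. c * u x) = 1"
    by (auto intro: cinner_on_normalize[OF finite_A, of _ u])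
  have "mult_vec_on A h (\<lambda>x. c * u x) x = e * (c * u x)" if "x \<in> A" for x
    using eigen[OF that] by (simp add: mult_vec_on_scale)
  moreover from this have "e \<in> \<real>" by (rule hermitian_on_eigenvalue_real[OF herm unit])
  ultimately show thesis using that unit \<open>e \<noteq> 0\<close> by (auto elim!: Reals_cases)
qed

lemma hermitian_on_eigenvector_orthogonal_kernel:
  assumes herm: "hermitian_on A h" and "e \<noteq> 0"
    and eigen: "\<And>x. x \<in> A \<Longrightarrow> mult_vec_on A h w x = e * w x"
    and kernel: "\<And>x. x \<in> A \<Longrightarrow> mult_vec_on A h u x = 0"
  shows "cinner_on A u w = 0"
proof -
  have "e * cinner_on A u w = cinner_on A u (mult_vec_on A h w)"
    using eigen by (simp add: cinner_on_scale_right cong: cinner_on_cong)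
  also have "\<dots> = cinner_on A (mult_vec_on A h u) w" by (rule cinner_on_hermitian[OF herm])
  also have "\<dots> = 0" using kernel by (simp add: cinner_on_def)
  finally show ?thesis using \<open>e \<noteq> 0\<close> by simp
qed

definition complement_proj :: "'k set \<Rightarrow> ('k \<Rightarrow> 'a \<Rightarrow> complex) \<Rightarrow> 'a \<Rightarrow> 'a \<Rightarrow> complex" where
  "complement_proj K q x y = of_bool (x = y) - dyad_sum K (\<lambda>_. 1) q q x y"

lemma cnj_complement_proj: "cnj (complement_proj K q x y) = complement_proj K q y x"
  by (simp add: complement_proj_def cnj_dyad_sum eq_commute)

lemma mult_vec_on_complement_proj:
  assumes "finite A" "x \<in> A"
  shows "mult_vec_on A (complement_proj K q) u x = u x - mult_vec_on A (dyad_sum K (\<lambda>_. 1) q q) u x"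
proof -
  have "mult_vec_on A (complement_proj K q) u x =
      (\<Sum>y\<in>A. of_bool (x = y) * u y) - mult_vec_on A (dyad_sum K (\<lambda>_. 1) q q) u x"
    by (simp add: mult_vec_on_def complement_proj_def left_diff_distrib sum_subtractf)
  then show ?thesis using assms by (simp add: of_bool_def if_distribR if_distrib cong: if_cong)
qed

text \<open>The squared Frobenius norm of a projection is its trace.\<close>
lemma complement_proj_frobenius_norm:
  assumes finite_A: "finite A" and finite_K: "finite K" and orth: "orthonormal_on A K q"
  shows "(\<Sum>x\<in>A. \<Sum>y\<in>A. (cmod (complement_proj K q x y))\<^sup>2) = real (card A) - real (card K)"
proof -
  let ?R = "complement_proj K q"
  have "(\<Sum>y\<in>A. ?R x y * cnj (?R x y)) = ?R x x" if "x \<in> A" for x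
  proof -
    have "cinner_on A (q k) (\<lambda>y. ?R y x) = 0" if "k \<in> K" for k
    proof -
      have "cinner_on A (q k) (\<lambda>y. ?R y x) =
          (\<Sum>y\<in>A. cnj (q k y) * of_bool (y = x)) - cinner_on A (q k) (\<lambda>y. \<Sum>j\<in>K. cnj (q j x) * q j y)"
        by (simp add: cinner_on_def complement_proj_def dyad_sum_def right_diff_distrib
            sum_subtractf ac_simps)
      then show ?thesis
        using finite_A \<open>x \<in> A\<close> \<open>k \<in> K\<close>
        by (simp add: cinner_on_basis_sum[OF finite_K orth] of_bool_def if_distrib cong: if_cong)
    qed
    moreover have "(\<Sum>y\<in>A. ?R x y * cnj (?R x y)) = mult_vec_on A ?R (\<lambda>y. ?R y x) x"
      by (simp add: mult_vec_on_def cnj_complement_proj)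
    ultimately show ?thesis using finite_A \<open>x \<in> A\<close>
      by (simp add: mult_vec_on_complement_proj mult_vec_on_dyad_sum)
  qed
  then have "(\<Sum>x\<in>A. \<Sum>y\<in>A. ?R x y * cnj (?R x y)) = (\<Sum>x\<in>A. ?R x x)" by simp
  also have "\<dots> = of_nat (card A) - of_nat (card K)"
    using trace_dyad_sum[OF orth] by (simp add: complement_proj_def sum_subtractf)
  finally have "complex_of_real (\<Sum>x\<in>A. \<Sum>y\<in>A. (cmod (?R x y))\<^sup>2) =
      of_real (real (card A) - real (card K))"
    by (simp add: of_real_norm_power2)
  then show ?thesis by (simp only: of_real_eq_iff)
qed

lemma orthonormal_on_complete:
  assumes finite_A: "finite A" and orth: "orthonormal_on A A q" and "x \<in> A"
  shows "u x = (\<Sum>k\<in>A. cinner_on A (q k) u * q k x)"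
proof -
  have "(\<Sum>x\<in>A. \<Sum>y\<in>A. (cmod (complement_proj A q x y))\<^sup>2) = 0"
    using complement_proj_frobenius_norm[OF finite_A finite_A orth] by simp
  then have "complement_proj A q x y = 0" if "y \<in> A" for y
    using finite_A \<open>x \<in> A\<close> that by (simp add: sum_nonneg_eq_0_iff sum_nonneg)
  then have "mult_vec_on A (complement_proj A q) u x = 0" by (simp add: mult_vec_on_def)
  then show ?thesis using finite_A \<open>x \<in> A\<close>
    by (simp add: mult_vec_on_complement_proj mult_vec_on_dyad_sum)
qed

definition eigensystem_on ::
  "'a set \<Rightarrow> ('a \<Rightarrow> 'a \<Rightarrow> complex) \<Rightarrow> 'k set \<Rightarrow> ('k \<Rightarrow> 'a \<Rightarrow> complex) \<Rightarrow> ('k \<Rightarrow> real) \<Rightarrow> bool" where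
  "eigensystem_on A h K q l \<longleftrightarrow>
    orthonormal_on A K q \<and> (\<forall>k\<in>K. \<forall>x\<in>A. mult_vec_on A h (q k) x = of_real (l k) * q k x)"

text \<open>An eigenvector for a nonzero eigenvalue of the deflated form is orthogonal to every \<open>q k\<close>. The
  multiple of the complementary projection only ensures that the deflated form does not vanish.\<close>
lemma eigensystem_on_extend:
  assumes finite_A: "finite A" and herm: "hermitian_on A h"
    and finite_K: "finite K" and card_less: "card K < card A"
    and eigensys: "eigensystem_on A h K q l"
  obtains e w where "cinner_on A w w = 1" "\<And>k. k \<in> K \<Longrightarrow> cinner_on A (q k) w = 0"
    "\<And>x. x \<in> A \<Longrightarrow> mult_vec_on A h w x = complex_of_real e * w x"
proof -
  let ?R = "complement_proj K q"
  from eigensys have orth: "orthonormal_on A K q"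
    and eigen: "\<And>k x. k \<in> K \<Longrightarrow> x \<in> A \<Longrightarrow> mult_vec_on A h (q k) x = of_real (l k) * q k x"
    by (simp_all add: eigensystem_on_def)
  define g where "g t x y = h x y - dyad_sum K l q q x y + complex_of_real t * ?R x y" for t x y
  have g_apply: "mult_vec_on A (g t) u x =
      mult_vec_on A h u x - mult_vec_on A (dyad_sum K l q q) u x
      + of_real t * (u x - mult_vec_on A (dyad_sum K (\<lambda>_. 1) q q) u x)" if "x \<in> A" for t u x
    unfolding mult_vec_on_complement_proj[OF finite_A that, symmetric]
    by (simp add: mult_vec_on_def g_def algebra_simps sum.distrib sum_subtractf sum_distrib_left)
  have g_herm: "hermitian_on A (g t)" for t
    using herm by (simp add: hermitian_on_def g_def cnj_dyad_sum cnj_complement_proj)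
  have g_basis: "mult_vec_on A (g t) (q k) x = 0" if "k \<in> K" "x \<in> A" for t k x
    using that by (simp add: g_apply eigen mult_vec_on_dyad_sum_basis[OF finite_K orth])
  have "(\<Sum>x\<in>A. \<Sum>y\<in>A. (cmod (?R x y))\<^sup>2) \<noteq> 0"
    using complement_proj_frobenius_norm[OF finite_A finite_K orth] card_less by simp
  then obtain x y where "x \<in> A" "y \<in> A" "?R x y \<noteq> 0"
    by (metis (no_types, lifting) norm_zero power_zero_numeral sum.neutral)
  moreover from this have "g 1 x y - g 0 x y \<noteq> 0" by (simp add: g_def)
  ultimately obtain t where "\<exists>x\<in>A. \<exists>y\<in>A. g t x y \<noteq> 0" by (metis diff_self)
  then obtain e w where "e \<noteq> 0" and unit: "cinner_on A w w = 1"
    and g_eigen: "\<And>x. x \<in> A \<Longrightarrow> mult_vec_on A (g t) w x = of_real e * w x"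
    by (rule hermitian_on_unit_eigenvector[OF finite_A g_herm]) blast
  have perp: "cinner_on A (q k) w = 0" if "k \<in> K" for k
    using \<open>e \<noteq> 0\<close> g_eigen g_basis[OF that]
    by (intro hermitian_on_eigenvector_orthogonal_kernel[OF g_herm, of "of_real e"]) auto
  then have "mult_vec_on A h w x = of_real (e - t) * w x" if "x \<in> A" for x
    using that g_eigen[OF that] by (simp add: g_apply mult_vec_on_dyad_sum algebra_simps)
  with unit perp show thesis by (rule that)
qed

lemma hermitian_on_eigensystem:
  assumes finite_A: "finite A" and herm: "hermitian_on A h"
  obtains q l where "eigensystem_on A h A q l"
proof -
  have "\<exists>q l. eigensystem_on A h K q l" if "finite K" "K \<subseteq> A" for K
    using that
  proof (induction rule: finite_induct)
    case empty
    then show ?case by (simp add: eigensystem_on_def orthonormal_on_def)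
  next
    case (insert k K)
    then obtain q l where eigensys: "eigensystem_on A h K q l" by auto
    moreover have "card K < card A" using insert finite_A by (intro psubset_card_mono) auto
    ultimately obtain e w
      where unit: "cinner_on A w w = 1" and perp: "\<And>j. j \<in> K \<Longrightarrow> cinner_on A (q j) w = 0"
        and eigen: "\<And>x. x \<in> A \<Longrightarrow> mult_vec_on A h w x = of_real e * w x"
      using eigensystem_on_extend[OF finite_A herm insert.hyps(1)] by metis
    have "cinner_on A w (q j) = 0" if "j \<in> K" for j
      using perp[OF that] cnj_cinner_on[of A "q j" w] by simp
    then have "eigensystem_on A h (insert k K) (q(k := w)) (l(k := e))"
      using eigensys unit perp eigen insert.hyps(2)
      by (auto simp: eigensystem_on_def orthonormal_on_def)
    then show ?case by blast
  qed
  with finite_A that show thesis by blast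
qed

section \<open>Positive square roots and the trace norm\<close>

definition positive_on :: "'a set \<Rightarrow> ('a \<Rightarrow> 'a \<Rightarrow> complex) \<Rightarrow> bool" where
  "positive_on A h \<longleftrightarrow> hermitian_on A h \<and> (\<forall>u. 0 \<le> Re (cinner_on A u (mult_vec_on A h u)))"

lemma positive_on_cong:
  assumes "\<And>x y. x \<in> A \<Longrightarrow> y \<in> A \<Longrightarrow> g x y = h x y"
  shows "positive_on A g \<longleftrightarrow> positive_on A h"
proof -
  have "cinner_on A u (mult_vec_on A g u) = cinner_on A u (mult_vec_on A h u)" for u
    using assms by (intro cinner_on_cong mult_vec_on_cong) auto
  then show ?thesis using assms by (simp add: positive_on_def hermitian_on_def)
qed

text \<open>An eigenvector \<open>w\<close> of \<open>s - t\<close> with eigenvalue \<open>e \<noteq> 0\<close> satisfies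
  \<open>e * (\<langle>w, s w\<rangle> + \<langle>w, t w\<rangle>) = \<langle>w, (s\<^sup>2 - t\<^sup>2) w\<rangle> = 0\<close>, so that both summands vanish
  although they differ by \<open>e\<close>.\<close>
lemma positive_on_square_inject:
  assumes finite_A: "finite A" and positive: "positive_on A s" "positive_on A t"
    and square: "\<And>x z. x \<in> A \<Longrightarrow> z \<in> A \<Longrightarrow>
      (\<Sum>y\<in>A. s x y * s y z) = (\<Sum>y\<in>A. t x y * t y z)"
    and "x \<in> A" "y \<in> A"
  shows "s x y = t x y"
proof (rule ccontr)
  assume "s x y \<noteq> t x y"
  then have nonzero: "\<exists>x\<in>A. \<exists>y\<in>A. s x y - t x y \<noteq> 0" using \<open>x \<in> A\<close> \<open>y \<in> A\<close> by auto
  have herm: "hermitian_on A s" "hermitian_on A t"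
    and form_nonneg: "0 \<le> Re (cinner_on A u (mult_vec_on A s u))"
      "0 \<le> Re (cinner_on A u (mult_vec_on A t u))" for u
    using positive by (simp_all add: positive_on_def)
  then have "hermitian_on A (\<lambda>x y. s x y - t x y)" by (simp add: hermitian_on_def)
  then obtain e w where "e \<noteq> 0" and unit: "cinner_on A w w = 1"
    and eigen: "\<And>x. x \<in> A \<Longrightarrow> mult_vec_on A (\<lambda>x y. s x y - t x y) w x = of_real e * w x"
    using hermitian_on_unit_eigenvector[OF finite_A _ nonzero] by metis
  define a b where "a = mult_vec_on A s w" and "b = mult_vec_on A t w"
  have a_eq: "a x = b x + of_real e * w x" if "x \<in> A" for x
    using eigen[OF that]
    by (simp add: a_def b_def mult_vec_on_def left_diff_distrib sum_subtractf diff_eq_eq)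
  have inner_a: "cinner_on A u a = cinner_on A u b + of_real e * cinner_on A u w" for u
    using a_eq by (simp add: cinner_on_add_right cinner_on_scale_right cong: cinner_on_cong)
  have "cinner_on A b b = cinner_on A a a"
    unfolding a_def b_def herm[THEN cinner_on_hermitian_square]
    by (intro cinner_on_cong mult_vec_on_cong) (simp_all add: square)
  also have "\<dots> = cinner_on A a b + of_real e * cinner_on A a w" by (rule inner_a)
  also have "cinner_on A a b = cinner_on A b b + of_real e * cinner_on A w b"
    using cnj_cinner_on[of A b a] by (simp add: inner_a cnj_cinner_on)
  finally have "cinner_on A w b + cinner_on A a w = 0"
    using \<open>e \<noteq> 0\<close> by (simp flip: distrib_left)
  then have "Re (cinner_on A w b) + Re (cinner_on A w a) = 0"
    using cnj_cinner_on[of A w a] by (auto simp: complex_eq_iff)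
  then have "Re (cinner_on A w a) = Re (cinner_on A w b)"
    using form_nonneg[of w] by (simp add: a_def b_def)
  then show False using inner_a[of w] unit \<open>e \<noteq> 0\<close> by simp
qed

lemma psd_iff_positive_on:
  "psd n M \<longleftrightarrow> M \<in> carrier_mat n n \<and> positive_on {..<n} (\<lambda>i j. M $$ (i, j))"
proof (cases "M \<in> carrier_mat n n")
  case True
  let ?form = "\<lambda>v. cinner_on {..<n} v (mult_vec_on {..<n} (\<lambda>i j. M $$ (i, j)) v)"
  have "adj M = M \<longleftrightarrow> (\<forall>i<n. \<forall>j<n. adj M $$ (j, i) = M $$ (j, i))"
    using True by (auto simp: mat_eq_iff adj_def)
  also have "\<dots> \<longleftrightarrow> hermitian_on {..<n} (\<lambda>i j. M $$ (i, j))"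
    using True by (auto simp: hermitian_on_def adj_def)
  finally have herm: "adj M = M \<longleftrightarrow> hermitian_on {..<n} (\<lambda>i j. M $$ (i, j))" .
  have form: "(\<Sum>i<n. cnj (v $ i) * (M *\<^sub>v v) $ i) = ?form (($) v)" if "v \<in> carrier_vec n" for v
    using True that by (simp add: cinner_on_def mult_vec_on_def scalar_prod_def lessThan_atLeast0)
  have "?form (($) (vec n u)) = ?form u" for u
    by (intro cinner_on_cong mult_vec_on_cong) auto
  then have "(\<forall>v\<in>carrier_vec n. 0 \<le> Re (?form (($) v))) \<longleftrightarrow> (\<forall>u. 0 \<le> Re (?form u))"
    by (metis vec_carrier)
  with True herm form show ?thesis by (simp add: psd_def positive_on_def)
qed (simp add: psd_def)

lemma psd_carrier: "psd n M \<Longrightarrow> M \<in> carrier_mat n n"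
  by (simp add: psd_def)

lemma psd_square_inject:
  assumes psd: "psd n S" "psd n T" and square: "S * S = T * T"
  shows "S = T"
proof -
  have carrier: "S \<in> carrier_mat n n" "T \<in> carrier_mat n n"
    using psd by (simp_all add: psd_carrier)
  have entry: "(\<Sum>k<n. M $$ (i, k) * M $$ (k, j)) = (M * M) $$ (i, j)"
    if "M \<in> carrier_mat n n" "i < n" "j < n" for M :: "complex mat" and i j
    using that by (simp add: scalar_prod_def lessThan_atLeast0)
  have "S $$ (i, j) = T $$ (i, j)" if "i < n" "j < n" for i j
    using psd carrier that unfolding psd_iff_positive_on
    by (intro positive_on_square_inject[of "{..<n}" "\<lambda>i j. S $$ (i, j)" "\<lambda>i j. T $$ (i, j)"])
      (simp_all add: entry square del: index_mult_mat)
  then show ?thesis using carrier by (intro eq_matI) auto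
qed

lemma psd_sqrt_square:
  assumes "psd n S"
  shows "psd_sqrt (S * S) = S"
proof -
  have "dim_row (S * S) = n" using psd_carrier[OF assms] by simp
  then show ?thesis
    unfolding psd_sqrt_def using assms by (intro the_equality) (auto intro: psd_square_inject)
qed

lemma positive_on_dyad_sum:
  assumes "\<And>k. k \<in> K \<Longrightarrow> 0 \<le> a k"
  shows "positive_on A (dyad_sum K a e e)"
proof -
  have "0 \<le> Re (cinner_on A u (mult_vec_on A (dyad_sum K a e e) u))" for u
  proof -
    have "cinner_on A u (mult_vec_on A (dyad_sum K a e e) u) =
        (\<Sum>k\<in>K. of_real (a k) * (cinner_on A (e k) u * cnj (cinner_on A (e k) u)))"
      unfolding mult_vec_on_dyad_sum[abs_def]
      by (simp add: cinner_on_sum_right cinner_on_scale_right cnj_cinner_on mult.assoc)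
    also have "\<dots> = of_real (\<Sum>k\<in>K. a k * (cmod (cinner_on A (e k) u))\<^sup>2)"
      by (simp add: of_real_norm_power2)
    finally show ?thesis using assms by (simp add: sum_nonneg)
  qed
  then show ?thesis by (simp add: positive_on_def hermitian_on_def cnj_dyad_sum)
qed

lemma trace_norm_dyad_sum:
  assumes finite_K: "finite K"
    and orth_e: "orthonormal_on {..<n} K e" and orth_f: "orthonormal_on {..<n} K f"
    and nonneg: "\<And>k. k \<in> K \<Longrightarrow> 0 \<le> a k"
  shows "trace_norm (mat n n (\<lambda>(i, j). dyad_sum K a e f i j)) = (\<Sum>k\<in>K. a k)"
proof -
  define D where "D e f = mat n n (\<lambda>(i, j). dyad_sum K a e f i j)" for e f
  have adj_D: "adj (D e f) = D f e" for e f
    by (auto simp: D_def adj_def cnj_dyad_sum)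
  have mult_D: "D g h * D h g' = mat n n (\<lambda>(i, j). dyad_sum K (\<lambda>k. a k * a k) g g' i j)"
    if "orthonormal_on {..<n} K h" for g h g'
    using dyad_sum_compose[OF finite_K that, of a g _ a g']
    by (auto simp: D_def scalar_prod_def lessThan_atLeast0)
  have "psd n (D f f)"
    using positive_on_dyad_sum[of K a "{..<n}" f] nonneg
    by (subst psd_iff_positive_on, subst positive_on_cong[where h = "dyad_sum K a f f"])
      (auto simp: D_def)
  moreover have "adj (D e f) * D e f = D f f * D f f"
    by (simp add: adj_D mult_D orth_e orth_f)
  ultimately have "trace_norm (D e f) = Re (mtrace (D f f))"
    by (simp add: trace_norm_def psd_sqrt_square)
  also have "mtrace (D f f) = of_real (\<Sum>k\<in>K. a k)"
    using trace_dyad_sum[OF orth_f] by (simp add: mtrace_def D_def)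
  finally show ?thesis by (simp add: D_def)
qed

section \<open>Schmidt decomposition of bipartite pure states\<close>

locale schmidt_decomposition =
  fixes A :: "'a set" and B :: "'b set" and \<phi> :: "'a \<Rightarrow> 'b \<Rightarrow> complex"
    and K :: "'k set" and s :: "'k \<Rightarrow> real" and q :: "'k \<Rightarrow> 'a \<Rightarrow> complex" and v :: "'k \<Rightarrow> 'b \<Rightarrow> complex"
  assumes finite_K: "finite K"
    and coeff_pos: "\<And>k. k \<in> K \<Longrightarrow> 0 < s k"
    and orthonormal_left: "orthonormal_on A K q" and orthonormal_right: "orthonormal_on B K v"
    and expansion: "\<And>x y. x \<in> A \<Longrightarrow> y \<in> B \<Longrightarrow> \<phi> x y = dyad_sum K s q v x y"

lemma cinner_on_adjoint_eigenvectors: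
  assumes eigensys: "eigensystem_on A (\<lambda>x x'. \<Sum>y\<in>B. \<phi> x y * cnj (\<phi> x' y)) K q l"
    and basis: "j \<in> K" "k \<in> K"
  defines "w \<equiv> \<lambda>k. mult_vec_on A (\<lambda>y x. cnj (\<phi> x y)) (q k)"
  shows "cinner_on B (w j) (w k) = of_real (l j) * of_bool (j = k)"
proof -
  have "cinner_on B (w j) (w k) = cinner_on A (mult_vec_on B \<phi> (w j)) (q k)"
    by (subst (2) w_def) (simp add: cinner_on_mult_vec_on)
  also have "\<dots> = cinner_on A (\<lambda>x. of_real (l j) * q j x) (q k)"
    using eigensys basis by (intro cinner_on_cong)
      (simp_all add: w_def mult_vec_on_mult_vec_on eigensystem_on_def)
  finally show ?thesis
    using eigensys basis by (simp add: cinner_on_scale_left eigensystem_on_def orthonormal_on_def)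
qed

lemma orthonormal_on_adjoint_expansion:
  assumes "finite A" "orthonormal_on A A q" "x \<in> A"
  shows "\<phi> x y = (\<Sum>k\<in>A. q k x * cnj (mult_vec_on A (\<lambda>y x. cnj (\<phi> x y)) (q k) y))"
  using orthonormal_on_complete[OF assms, of "\<lambda>x. \<phi> x y"]
  by (simp add: cinner_on_def mult_vec_on_def mult.commute)

lemma schmidt_decomposition_exists:
  fixes \<phi> :: "'a \<Rightarrow> 'b \<Rightarrow> complex"
  assumes finite_A: "finite A" and finite_B: "finite B"
  obtains K and s :: "'a \<Rightarrow> real" and q v where "K \<subseteq> A" "schmidt_decomposition A B \<phi> K s q v"
proof -
  let ?h = "\<lambda>x x'. \<Sum>y\<in>B. \<phi> x y * cnj (\<phi> x' y)"
  have "hermitian_on A ?h" by (simp add: hermitian_on_def mult.commute)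
  then obtain q l where eigensys: "eigensystem_on A ?h A q l"
    using hermitian_on_eigensystem[OF finite_A] by blast
  then have orth: "orthonormal_on A A q" by (simp add: eigensystem_on_def)
  define w where "w k = mult_vec_on A (\<lambda>y x. cnj (\<phi> x y)) (q k)" for k
  note gram = cinner_on_adjoint_eigenvectors[OF eigensys, folded w_def]
  have w_norm: "(\<Sum>y\<in>B. (cmod (w k y))\<^sup>2) = l k" if "k \<in> A" for k
    using gram[OF that that] unfolding cinner_on_self by (simp flip: of_real_power of_real_sum)
  have l_nonneg: "0 \<le> l k" if "k \<in> A" for k
    using w_norm[OF that] sum_nonneg[of B "\<lambda>y. (cmod (w k y))\<^sup>2"] by simp
  have w_eq_0: "w k y = 0" if "k \<in> A" "l k = 0" "y \<in> B" for k y
    using w_norm[OF that(1)] that finite_B by (simp add: sum_nonneg_eq_0_iff)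
  define K where "K = {k \<in> A. l k \<noteq> 0}"
  define v where "v k y = of_real (1 / sqrt (l k)) * w k y" for k y
  have "cinner_on B (v j) (v k) = of_real (1 / sqrt (l j) * (1 / sqrt (l k)) * l j) *
      of_bool (j = k)" if "j \<in> A" "k \<in> A" for j k
    unfolding v_def[abs_def] cinner_on_scale_left cinner_on_scale_right gram[OF that] by simp
  then have "orthonormal_on B K v"
    using l_nonneg by (auto simp: orthonormal_on_def K_def simp flip: of_real_mult)
  moreover have "\<phi> x y = dyad_sum K (\<lambda>k. sqrt (l k)) q v x y" if "x \<in> A" "y \<in> B" for x y
  proof -
    have "\<phi> x y = (\<Sum>k\<in>A. q k x * cnj (w k y))"
      unfolding w_def by (rule orthonormal_on_adjoint_expansion[OF finite_A orth \<open>x \<in> A\<close>])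
    also have "\<dots> = (\<Sum>k\<in>K. q k x * cnj (w k y))"
      using finite_A \<open>y \<in> B\<close> by (intro sum.mono_neutral_right) (auto simp: K_def w_eq_0)
    also have "\<dots> = dyad_sum K (\<lambda>k. sqrt (l k)) q v x y"
      by (auto simp: dyad_sum_def v_def K_def intro!: sum.cong)
    finally show ?thesis .
  qed
  ultimately have "schmidt_decomposition A B \<phi> K (\<lambda>k. sqrt (l k)) q v"
    using finite_A orth l_nonneg
    by unfold_locales (auto simp: K_def orthonormal_on_def less_le)
  then show thesis using that[of K] by (auto simp: K_def)
qed

definition purity :: "'a set \<Rightarrow> 'b set \<Rightarrow> ('a \<Rightarrow> 'b \<Rightarrow> complex) \<Rightarrow> real" where
  "purity A B \<phi> = (\<Sum>x\<in>A. \<Sum>x'\<in>A. (cmod (\<Sum>y\<in>B. \<phi> x y * cnj (\<phi> x' y)))\<^sup>2)"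

context schmidt_decomposition
begin

lemma reduced_state:
  assumes "x \<in> A" "x' \<in> A"
  shows "(\<Sum>y\<in>B. \<phi> x y * cnj (\<phi> x' y)) = dyad_sum K (\<lambda>k. (s k)\<^sup>2) q q x x'"
  using assms dyad_sum_compose[OF finite_K orthonormal_right, of s q x s q x']
  by (simp add: expansion cnj_dyad_sum power2_eq_square)

lemma norm_eq_sum_power2: "(\<Sum>x\<in>A. \<Sum>y\<in>B. (cmod (\<phi> x y))\<^sup>2) = (\<Sum>k\<in>K. (s k)\<^sup>2)"
proof -
  have "complex_of_real (\<Sum>x\<in>A. \<Sum>y\<in>B. (cmod (\<phi> x y))\<^sup>2) = (\<Sum>x\<in>A. dyad_sum K (\<lambda>k. (s k)\<^sup>2) q q x x)"
    by (simp add: of_real_norm_power2 reduced_state)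
  also have "\<dots> = of_real (\<Sum>k\<in>K. (s k)\<^sup>2)" by (rule trace_dyad_sum[OF orthonormal_left])
  finally show ?thesis by (simp only: of_real_eq_iff)
qed

lemma purity_eq_sum_power4: "purity A B \<phi> = (\<Sum>k\<in>K. (s k) ^ 4)"
proof -
  let ?\<rho> = "dyad_sum K (\<lambda>k. (s k)\<^sup>2) q q"
  have "complex_of_real (purity A B \<phi>) = (\<Sum>x\<in>A. \<Sum>x'\<in>A. ?\<rho> x x' * ?\<rho> x' x)"
    by (simp add: purity_def reduced_state of_real_norm_power2 cnj_dyad_sum)
  also have "\<dots> = (\<Sum>x\<in>A. dyad_sum K (\<lambda>k. (s k)\<^sup>2 * (s k)\<^sup>2) q q x x)"
    by (simp add: dyad_sum_compose[OF finite_K orthonormal_left])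
  also have "\<dots> = of_real (\<Sum>k\<in>K. (s k)\<^sup>2 * (s k)\<^sup>2)" by (rule trace_dyad_sum[OF orthonormal_left])
  finally show ?thesis by (simp only: of_real_eq_iff flip: power_add) simp
qed

end

section \<open>Trace norm of the partial transpose\<close>

lemma orthonormal_on_cnj: "orthonormal_on A K q \<Longrightarrow> orthonormal_on A K (\<lambda>k x. cnj (q k x))"
  by (auto simp: orthonormal_on_def cinner_on_def mult.commute)

lemma orthonormal_on_tensor:
  assumes "orthonormal_on A K q" "orthonormal_on B L v"
  shows "orthonormal_on (A \<times> B) (K \<times> L) (\<lambda>(k, l) (x, y). q k x * v l y)"
proof -
  have "cinner_on (A \<times> B) (\<lambda>(x, y). q k x * v l y) (\<lambda>(x, y). q k' x * v l' y) =
      cinner_on A (q k) (q k') * cinner_on B (v l) (v l')" for k l k' l'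
    by (simp add: cinner_on_def sum_product sum.cartesian_product case_prod_unfold ac_simps)
  then show ?thesis using assms by (auto simp: orthonormal_on_def)
qed

lemma orthonormal_on_reindex_bij_betw:
  assumes "bij_betw f I A" "orthonormal_on A K q"
  shows "orthonormal_on I K (\<lambda>k i. q k (f i))"
proof -
  have "cinner_on I (\<lambda>i. q j (f i)) (\<lambda>i. q k (f i)) = cinner_on A (q j) (q k)" for j k
    unfolding cinner_on_def by (rule sum.reindex_bij_betw[OF assms(1)])
  then show ?thesis using assms(2) by (simp add: orthonormal_on_def)
qed

text \<open>The matrix of the partial transpose of \<open>|\<phi>\<rangle>\<langle>\<phi>|\<close> in a basis whose \<open>i\<close>-th element is the product
  vector with indices \<open>\<alpha> i\<close> and \<open>\<beta> i\<close>.\<close>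
definition pure_ptrans :: "nat \<Rightarrow> (nat \<Rightarrow> 'a) \<Rightarrow> (nat \<Rightarrow> 'b) \<Rightarrow> ('a \<Rightarrow> 'b \<Rightarrow> complex) \<Rightarrow> complex mat" where
  "pure_ptrans n \<alpha> \<beta> \<phi> = mat n n (\<lambda>(i, j). \<phi> (\<alpha> j) (\<beta> i) * cnj (\<phi> (\<alpha> i) (\<beta> j)))"

text \<open>The singular value decomposition of the partial transpose is \<open>\<Sum> s\<^sub>k s\<^sub>l |e\<^sub>l\<^sub>k\<rangle>\<langle>e\<^sub>k\<^sub>l|\<close>, where
  \<open>e\<^sub>k\<^sub>l\<close> is the complex conjugate of \<open>q\<^sub>k \<otimes> v\<^sub>l\<close>.\<close>
lemma (in schmidt_decomposition) trace_norm_pure_ptrans: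
  assumes bij: "bij_betw (\<lambda>i. (\<alpha> i, \<beta> i)) {..<n} (A \<times> B)"
  shows "trace_norm (pure_ptrans n \<alpha> \<beta> \<phi>) = (\<Sum>k\<in>K. s k)\<^sup>2"
proof -
  define e where "e = (\<lambda>(k, l) i. cnj (q k (\<alpha> i) * v l (\<beta> i)))"
  define a where "a = (\<lambda>(k, l). s k * s l)"
  have "orthonormal_on {..<n} (K \<times> K) e"
    using orthonormal_on_cnj[OF orthonormal_on_reindex_bij_betw[OF bij
          orthonormal_on_tensor[OF orthonormal_left orthonormal_right]]]
    by (simp add: e_def case_prod_unfold)
  moreover from this have "orthonormal_on {..<n} (K \<times> K) (\<lambda>p. e (prod.swap p))"
    by (auto simp: orthonormal_on_def)
  moreover have "0 \<le> a p" if "p \<in> K \<times> K" for p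
    using that by (auto simp: a_def intro!: mult_pos_pos less_imp_le coeff_pos)
  moreover have "pure_ptrans n \<alpha> \<beta> \<phi> =
      mat n n (\<lambda>(i, j). dyad_sum (K \<times> K) a (\<lambda>p. e (prod.swap p)) e i j)"
  proof -
    have "\<phi> (\<alpha> j) (\<beta> i) * cnj (\<phi> (\<alpha> i) (\<beta> j)) = dyad_sum (K \<times> K) a (\<lambda>p. e (prod.swap p)) e i j"
      if "i < n" "j < n" for i j
    proof -
      have "\<alpha> i \<in> A" "\<beta> i \<in> B" "\<alpha> j \<in> A" "\<beta> j \<in> B"
        using bij_betwE[OF bij] that by auto
      then show ?thesis
        by (simp add: expansion cnj_dyad_sum)
          (simp add: dyad_sum_def a_def e_def sum_product sum.cartesian_product case_prod_unfold
            ac_simps)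
    qed
    then show ?thesis unfolding pure_ptrans_def by (intro cong_mat) auto
  qed
  ultimately have "trace_norm (pure_ptrans n \<alpha> \<beta> \<phi>) = (\<Sum>p\<in>K \<times> K. a p)"
    using trace_norm_dyad_sum finite_K by (metis finite_cartesian_product)
  then show ?thesis
    by (simp add: a_def power2_eq_square sum_product sum.cartesian_product)
qed

section \<open>Negativity and concurrence\<close>

lemma sum_power2_le_power2_sum:
  fixes s :: "'k \<Rightarrow> real"
  assumes "\<And>k. k \<in> K \<Longrightarrow> 0 \<le> s k"
  shows "(\<Sum>k\<in>K. (s k)\<^sup>2) \<le> (\<Sum>k\<in>K. s k)\<^sup>2"
  using L2_set_le_sum[of K s] assms by (intro sqrt_le_D) (simp add: L2_set_def)

lemma power2_cross_terms_ge:
  fixes s :: "'k \<Rightarrow> real"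
  assumes "finite K" and "\<And>k. k \<in> K \<Longrightarrow> 0 \<le> s k"
  shows "2 * ((\<Sum>k\<in>K. (s k)\<^sup>2)\<^sup>2 - (\<Sum>k\<in>K. (s k) ^ 4)) \<le> ((\<Sum>k\<in>K. s k)\<^sup>2 - (\<Sum>k\<in>K. (s k)\<^sup>2))\<^sup>2"
  using assms
proof (induction rule: finite_induct)
  case (insert j K)
  define S Q R where "S = (\<Sum>k\<in>K. s k)" and "Q = (\<Sum>k\<in>K. (s k)\<^sup>2)" and "R = (\<Sum>k\<in>K. (s k) ^ 4)"
  have "Q \<le> S\<^sup>2" "0 \<le> S" and IH: "2 * (Q\<^sup>2 - R) \<le> (S\<^sup>2 - Q)\<^sup>2"
    using insert sum_power2_le_power2_sum[of K s] by (simp_all add: S_def Q_def R_def sum_nonneg)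
  have "2 * (((s j)\<^sup>2 + Q)\<^sup>2 - ((s j) ^ 4 + R)) = 2 * (Q\<^sup>2 - R) + 4 * (s j)\<^sup>2 * Q"
    by (simp add: power2_eq_square power4_eq_xxxx algebra_simps)
  also have "\<dots> \<le> (S\<^sup>2 - Q)\<^sup>2 + 4 * (s j)\<^sup>2 * S\<^sup>2"
    using IH \<open>Q \<le> S\<^sup>2\<close> by (intro add_mono mult_left_mono) auto
  also have "\<dots> \<le> (S\<^sup>2 - Q)\<^sup>2 + 4 * (s j)\<^sup>2 * S\<^sup>2 + 4 * (s j * S) * (S\<^sup>2 - Q)"
    using \<open>Q \<le> S\<^sup>2\<close> \<open>0 \<le> S\<close> insert.prems by simp
  also have "\<dots> = ((s j + S)\<^sup>2 - ((s j)\<^sup>2 + Q))\<^sup>2"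
    by (simp add: power2_eq_square algebra_simps)
  finally show ?case using insert.hyps by (simp add: S_def Q_def R_def)
qed simp

lemma power2_cross_terms_card_le_2:
  fixes s :: "'k \<Rightarrow> real"
  assumes "finite K" and "card K \<le> 2"
  shows "((\<Sum>k\<in>K. s k)\<^sup>2 - (\<Sum>k\<in>K. (s k)\<^sup>2))\<^sup>2 = 2 * ((\<Sum>k\<in>K. (s k)\<^sup>2)\<^sup>2 - (\<Sum>k\<in>K. (s k) ^ 4))"
proof -
  consider "K = {}" | j where "K = {j}" | j k where "K = {j, k}" "j \<noteq> k"
    using assms
    by (metis card_0_eq card_1_singletonE card_2_iff le_SucE le_zero_eq
        numeral_2_eq_2 One_nat_def)
  then show ?thesis
    by cases (simp_all add: power2_eq_square power4_eq_xxxx algebra_simps)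
qed

definition concurrence :: "'a set \<Rightarrow> 'b set \<Rightarrow> ('a \<Rightarrow> 'b \<Rightarrow> complex) \<Rightarrow> real" where
  "concurrence A B \<phi> = sqrt (2 * (1 - purity A B \<phi>))"

lemma purity_le_power2_norm:
  assumes "finite A" "finite B"
  shows "purity A B \<phi> \<le> (\<Sum>x\<in>A. \<Sum>y\<in>B. (cmod (\<phi> x y))\<^sup>2)\<^sup>2"
proof -
  obtain K and s :: "'a \<Rightarrow> real" and q v where "K \<subseteq> A" "schmidt_decomposition A B \<phi> K s q v"
    by (rule schmidt_decomposition_exists[OF assms])
  then interpret schmidt_decomposition A B \<phi> K s q v by simp
  show ?thesis
    unfolding norm_eq_sum_power2 purity_eq_sum_power4
    using sum_power2_le_power2_sum[of K "\<lambda>k. (s k)\<^sup>2"] by simp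
qed

lemma
  assumes fin: "finite A" "finite B" and norm: "(\<Sum>x\<in>A. \<Sum>y\<in>B. (cmod (\<phi> x y))\<^sup>2) = 1"
    and bij: "bij_betw (\<lambda>i. (\<alpha> i, \<beta> i)) {..<n} (A \<times> B)"
  shows trace_norm_pure_ptrans_ge_concurrence:
      "1 + concurrence A B \<phi> \<le> trace_norm (pure_ptrans n \<alpha> \<beta> \<phi>)"
    and trace_norm_pure_ptrans_eq_concurrence:
      "card A \<le> 2 \<Longrightarrow> trace_norm (pure_ptrans n \<alpha> \<beta> \<phi>) = 1 + concurrence A B \<phi>"
proof -
  obtain K and s :: "'a \<Rightarrow> real" and q v
    where subset: "K \<subseteq> A" and "schmidt_decomposition A B \<phi> K s q v"
    by (rule schmidt_decomposition_exists[OF fin])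
  then interpret schmidt_decomposition A B \<phi> K s q v by simp
  let ?T = "trace_norm (pure_ptrans n \<alpha> \<beta> \<phi>)"
  have s_nonneg: "\<And>k. k \<in> K \<Longrightarrow> 0 \<le> s k" by (simp add: coeff_pos less_imp_le)
  have T_eq: "?T = (\<Sum>k\<in>K. s k)\<^sup>2" by (rule trace_norm_pure_ptrans[OF bij])
  have sum_power2: "(\<Sum>k\<in>K. (s k)\<^sup>2) = 1" using norm_eq_sum_power2 norm by simp
  have T_ge: "1 \<le> ?T"
    using sum_power2_le_power2_sum[of K s, OF s_nonneg] by (simp add: T_eq sum_power2)
  have "2 * (1 - purity A B \<phi>) \<le> (?T - 1)\<^sup>2"
    using power2_cross_terms_ge[of K s, OF finite_K s_nonneg]
    by (simp add: T_eq sum_power2 purity_eq_sum_power4)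
  then have "concurrence A B \<phi> \<le> ?T - 1"
    unfolding concurrence_def using T_ge by (intro real_le_lsqrt) auto
  then show "1 + concurrence A B \<phi> \<le> ?T" by simp
  assume "card A \<le> 2"
  then have "card K \<le> 2" using card_mono[OF fin(1) subset] by simp
  then have "2 * (1 - purity A B \<phi>) = (?T - 1)\<^sup>2"
    using power2_cross_terms_card_le_2[OF finite_K, of s]
    by (simp add: T_eq sum_power2 purity_eq_sum_power4)
  then show "?T = 1 + concurrence A B \<phi>"
    using T_ge by (simp add: concurrence_def)
qed

section \<open>Subadditivity of the linear entropy\<close>

text \<open>With the unitaries \<open>F\<close>, \<open>G\<close> induced by \<open>f\<close>, \<open>g\<close>, this is \<open>\<parallel>(1 - F) (1 - G) \<Psi>\<parallel>\<^sup>2 \<ge> 0\<close>.\<close>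
lemma sum_inner_commuting_involutions_le:
  fixes \<Psi> :: "'a \<Rightarrow> 'b :: real_inner"
  assumes f: "\<And>p. p \<in> \<Omega> \<Longrightarrow> f p \<in> \<Omega>" "\<And>p. p \<in> \<Omega> \<Longrightarrow> f (f p) = p"
    and g: "\<And>p. p \<in> \<Omega> \<Longrightarrow> g p \<in> \<Omega>" "\<And>p. p \<in> \<Omega> \<Longrightarrow> g (g p) = p"
    and commute: "\<And>p. p \<in> \<Omega> \<Longrightarrow> f (g p) = g (f p)"
  shows "(\<Sum>p\<in>\<Omega>. inner (\<Psi> p) (\<Psi> (f p))) + (\<Sum>p\<in>\<Omega>. inner (\<Psi> p) (\<Psi> (g p)))
    \<le> (\<Sum>p\<in>\<Omega>. inner (\<Psi> p) (\<Psi> p)) + (\<Sum>p\<in>\<Omega>. inner (\<Psi> p) (\<Psi> (f (g p))))"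
proof -
  define fg where "fg p = f (g p)" for p
  define u where "u p = \<Psi> p - \<Psi> (f p) - \<Psi> (g p) + \<Psi> (fg p)" for p
  let ?I = "\<lambda>u v. \<Sum>p\<in>\<Omega>. inner (\<Psi> (u p)) (\<Psi> (v p))"
  have "bij_betw f \<Omega> \<Omega>" "bij_betw g \<Omega> \<Omega>"
    using f g by (auto intro: bij_betw_byWitness[where f' = f] bij_betw_byWitness[where f' = g])
  note reindex = this[THEN sum.reindex_bij_betw]
  have "?I f f = ?I id id"
    using reindex(1)[of "\<lambda>p. inner (\<Psi> p) (\<Psi> p)"] by simp
  moreover have "?I g g = ?I id id"
    using reindex(2)[of "\<lambda>p. inner (\<Psi> p) (\<Psi> p)"] by simp
  moreover have "?I fg fg = ?I f f"
    using reindex(2)[of "\<lambda>p. inner (\<Psi> (f p)) (\<Psi> (f p))"] by (simp add: fg_def)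
  moreover have "?I g fg = ?I id f"
    using reindex(2)[of "\<lambda>p. inner (\<Psi> p) (\<Psi> (f p))"] by (simp add: fg_def)
  moreover have "?I f fg = ?I id g"
    using reindex(1)[of "\<lambda>p. inner (\<Psi> p) (\<Psi> (g p))"] by (simp add: fg_def commute)
  moreover have "?I f g = ?I id fg"
    using reindex(1)[of "\<lambda>p. inner (\<Psi> (f p)) (\<Psi> (g p))"] by (simp add: fg_def f commute)
  moreover have "0 \<le> (\<Sum>p\<in>\<Omega>. inner (u p) (u p))"
    by (simp add: sum_nonneg)
  moreover have "(\<Sum>p\<in>\<Omega>. inner (u p) (u p)) = ?I id id + ?I f f + ?I g g + ?I fg fg
      - 2 * ?I id f - 2 * ?I id g + 2 * ?I id fg + 2 * ?I f g - 2 * ?I f fg - 2 * ?I g fg"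
    by (simp add: u_def inner_diff_left inner_diff_right inner_add_left inner_add_right
        inner_commute sum.distrib sum_subtractf algebra_simps flip: sum_distrib_left)
  ultimately show ?thesis by (simp add: fg_def)
qed

lemma override_on_self: "override_on f f X = f"
  by (simp add: override_on_def)

lemma bij_betw_restrict_PiE:
  assumes "X \<subseteq> I"
  shows "bij_betw (\<lambda>f. (restrict f X, restrict f (I - X))) (PiE I D) (PiE X D \<times> PiE (I - X) D)"
proof (rule bij_betw_byWitness[where f' = "\<lambda>(x, y). override_on y x X"])
  show "\<forall>f\<in>PiE I D. (case (restrict f X, restrict f (I - X)) of (x, y) \<Rightarrow> override_on y x X) = f"
    using assms by (auto simp: override_on_def fun_eq_iff PiE_def extensional_def)
  show "\<forall>p\<in>PiE X D \<times> PiE (I - X) D.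
      (\<lambda>f. (restrict f X, restrict f (I - X))) (case p of (x, y) \<Rightarrow> override_on y x X) = p"
    by (auto simp: override_on_def fun_eq_iff PiE_def extensional_def)
qed (use assms in \<open>auto simp: override_on_def PiE_def extensional_def Pi_def\<close>)

text \<open>A state of the parties \<open>I\<close> is given by its amplitudes \<open>\<Psi> f\<close>, where \<open>f\<close> assigns a basis index
  to each party.\<close>
definition split_amplitude ::
  "'i set \<Rightarrow> (('i \<Rightarrow> 'c) \<Rightarrow> complex) \<Rightarrow> ('i \<Rightarrow> 'c) \<Rightarrow> ('i \<Rightarrow> 'c) \<Rightarrow> complex" where
  "split_amplitude X \<Psi> x y = \<Psi> (override_on y x X)"

definition marginal_purity ::
  "'i set \<Rightarrow> ('i \<Rightarrow> 'c set) \<Rightarrow> (('i \<Rightarrow> 'c) \<Rightarrow> complex) \<Rightarrow> 'i set \<Rightarrow> real" where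
  "marginal_purity I D \<Psi> X = purity (PiE X D) (PiE (I - X) D) (split_amplitude X \<Psi>)"

lemma sum_PiE_split:
  assumes "X \<subseteq> I"
  shows "(\<Sum>x\<in>PiE X D. \<Sum>y\<in>PiE (I - X) D. h x y) =
    (\<Sum>f\<in>PiE I D. h (restrict f X) (restrict f (I - X)))"
  using sum.reindex_bij_betw[OF bij_betw_restrict_PiE[OF assms], of "\<lambda>(x, y). h x y" D]
  by (simp add: sum.cartesian_product)

lemma split_amplitude_restrict:
  assumes "X \<subseteq> I" "f \<in> PiE I D" "g \<in> PiE I D"
  shows "split_amplitude X \<Psi> (restrict f X) (restrict g (I - X)) = \<Psi> (override_on g f X)"
proof -
  have "override_on (restrict g (I - X)) (restrict f X) X = override_on g f X"
    using assms by (auto simp: override_on_def fun_eq_iff PiE_def extensional_def)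
  then show ?thesis by (simp add: split_amplitude_def)
qed

text \<open>The purity is the overlap of \<open>\<Psi> \<otimes> \<Psi>\<close> with its image under exchanging the \<open>X\<close> parts of the
  two copies.\<close>
lemma of_real_marginal_purity:
  assumes subset: "X \<subseteq> I"
  shows "complex_of_real (marginal_purity I D \<Psi> X) =
    (\<Sum>f\<in>PiE I D. \<Sum>g\<in>PiE I D. \<Psi> f * \<Psi> g * cnj (\<Psi> (override_on f g X) * \<Psi> (override_on g f X)))"
proof -
  let ?A = "PiE X D" and ?B = "PiE (I - X) D" and ?C = "PiE I D" and ?\<phi> = "split_amplitude X \<Psi>"
  have "complex_of_real (marginal_purity I D \<Psi> X) =
      (\<Sum>x\<in>?A. \<Sum>x'\<in>?A. \<Sum>y\<in>?B. \<Sum>y'\<in>?B. ?\<phi> x y * ?\<phi> x' y' * cnj (?\<phi> x' y * ?\<phi> x y'))"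
    by (simp add: marginal_purity_def purity_def of_real_norm_power2 sum_product ac_simps)
  also have "\<dots> = (\<Sum>x\<in>?A. \<Sum>y\<in>?B. \<Sum>x'\<in>?A. \<Sum>y'\<in>?B. ?\<phi> x y * ?\<phi> x' y' * cnj (?\<phi> x' y * ?\<phi> x y'))"
    by (intro sum.cong refl sum.swap)
  also have "\<dots> = (\<Sum>f\<in>?C. \<Sum>g\<in>?C. \<Psi> f * \<Psi> g * cnj (\<Psi> (override_on f g X) * \<Psi> (override_on g f X)))"
    unfolding sum_PiE_split[OF subset]
  proof (intro sum.cong refl)
    fix f g assume "f \<in> ?C" "g \<in> ?C"
    then show "?\<phi> (restrict f X) (restrict f (I - X)) * ?\<phi> (restrict g X) (restrict g (I - X)) *
        cnj (?\<phi> (restrict g X) (restrict f (I - X)) * ?\<phi> (restrict f X) (restrict g (I - X))) =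
      \<Psi> f * \<Psi> g * cnj (\<Psi> (override_on f g X) * \<Psi> (override_on g f X))"
      by (simp add: split_amplitude_restrict[OF subset, of _ D] override_on_self)
  qed
  finally show ?thesis .
qed

lemma marginal_purity_compl:
  assumes "X \<subseteq> I"
  shows "marginal_purity I D \<Psi> (I - X) = marginal_purity I D \<Psi> X"
proof -
  have "override_on f g (I - X) = override_on g f X" if "f \<in> PiE I D" "g \<in> PiE I D" for f g
    using assms that by (auto simp: override_on_def fun_eq_iff PiE_def extensional_def)
  then have "complex_of_real (marginal_purity I D \<Psi> (I - X)) = of_real (marginal_purity I D \<Psi> X)"
    unfolding of_real_marginal_purity[OF assms] of_real_marginal_purity[OF Diff_subset]
    by (intro sum.cong refl) (simp add: mult.commute)
  then show ?thesis by (simp only: of_real_eq_iff)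
qed

lemma marginal_purity_subadditive:
  fixes \<Psi> :: "('i \<Rightarrow> 'c) \<Rightarrow> complex"
  assumes subset: "X \<subseteq> I" "Y \<subseteq> I"
  shows "marginal_purity I D \<Psi> X + marginal_purity I D \<Psi> Y \<le>
    (\<Sum>f\<in>PiE I D. (cmod (\<Psi> f))\<^sup>2)\<^sup>2 + marginal_purity I D \<Psi> (sym_diff X Y)"
proof -
  define \<Omega> where "\<Omega> = PiE I D \<times> PiE I D"
  define \<Phi> where "\<Phi> = (\<lambda>(f, g). \<Psi> f * \<Psi> g)"
  define F :: "'i set \<Rightarrow> ('i \<Rightarrow> 'c) \<times> ('i \<Rightarrow> 'c) \<Rightarrow> ('i \<Rightarrow> 'c) \<times> ('i \<Rightarrow> 'c)"
    where "F Z = (\<lambda>(f, g). (override_on f g Z, override_on g f Z))" for Z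
  have F_in: "F Z p \<in> \<Omega>" if "p \<in> \<Omega>" for Z p
    using that by (auto simp: F_def \<Omega>_def override_on_def PiE_iff extensional_def split: if_splits)
  have F_F: "F Z (F Z' p) = F (sym_diff Z Z') p" for Z Z' p
    by (auto simp: F_def override_on_def fun_eq_iff split: prod.splits)
  have F_empty: "F {} p = p" for p
    by (simp add: F_def case_prod_unfold)
  have purity: "marginal_purity I D \<Psi> Z = (\<Sum>p\<in>\<Omega>. inner (\<Phi> p) (\<Phi> (F Z p)))" if "Z \<subseteq> I" for Z
  proof -
    have "complex_of_real (marginal_purity I D \<Psi> Z) = (\<Sum>p\<in>\<Omega>. \<Phi> p * cnj (\<Phi> (F Z p)))"
      unfolding of_real_marginal_purity[OF that] sum.cartesian_product \<Omega>_def \<Phi>_def F_def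
        case_prod_unfold by simp
    from arg_cong[OF this, of Re] show ?thesis by (simp add: inner_complex_def)
  qed
  have "(\<Sum>p\<in>\<Omega>. inner (\<Phi> p) (\<Phi> p)) = (\<Sum>f\<in>PiE I D. (cmod (\<Psi> f))\<^sup>2)\<^sup>2"
    unfolding power2_eq_square[of "sum _ _"] sum_product sum.cartesian_product
    by (simp add: \<Omega>_def \<Phi>_def case_prod_unfold norm_mult power_mult_distrib
        flip: power2_norm_eq_inner)
  moreover have "(\<Sum>p\<in>\<Omega>. inner (\<Phi> p) (\<Phi> (F X p))) + (\<Sum>p\<in>\<Omega>. inner (\<Phi> p) (\<Phi> (F Y p)))
      \<le> (\<Sum>p\<in>\<Omega>. inner (\<Phi> p) (\<Phi> p)) + (\<Sum>p\<in>\<Omega>. inner (\<Phi> p) (\<Phi> (F X (F Y p))))"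
    by (rule sum_inner_commuting_involutions_le) (simp_all add: F_in F_F F_empty Un_commute)
  moreover have "sym_diff X Y \<subseteq> I" using subset by auto
  ultimately show ?thesis using subset by (simp add: purity F_F)
qed

definition marginal_concurrence ::
  "'i set \<Rightarrow> ('i \<Rightarrow> 'c set) \<Rightarrow> (('i \<Rightarrow> 'c) \<Rightarrow> complex) \<Rightarrow> 'i set \<Rightarrow> real" where
  "marginal_concurrence I D \<Psi> X = concurrence (PiE X D) (PiE (I - X) D) (split_amplitude X \<Psi>)"

lemma sum_norm_split_amplitude:
  assumes "X \<subseteq> I"
  shows "(\<Sum>x\<in>PiE X D. \<Sum>y\<in>PiE (I - X) D. (cmod (split_amplitude X \<Psi> x y))\<^sup>2) =
    (\<Sum>f\<in>PiE I D. (cmod (\<Psi> f))\<^sup>2)"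
  by (simp add: sum_PiE_split[OF assms] split_amplitude_restrict[OF assms, of _ D] override_on_self)

lemma marginal_purity_le_1:
  assumes "finite I" "\<And>i. i \<in> I \<Longrightarrow> finite (D i)" "(\<Sum>f\<in>PiE I D. (cmod (\<Psi> f))\<^sup>2) = 1" "X \<subseteq> I"
  shows "marginal_purity I D \<Psi> X \<le> 1"
proof -
  have "finite (PiE X D)" "finite (PiE (I - X) D)"
    using assms by (auto intro!: finite_PiE intro: finite_subset)
  from purity_le_power2_norm[OF this, of "split_amplitude X \<Psi>"] show ?thesis
    by (simp add: marginal_purity_def sum_norm_split_amplitude assms)
qed

lemma marginal_concurrence_nonneg:
  assumes "finite I" "\<And>i. i \<in> I \<Longrightarrow> finite (D i)" "(\<Sum>f\<in>PiE I D. (cmod (\<Psi> f))\<^sup>2) = 1" "X \<subseteq> I"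
  shows "0 \<le> marginal_concurrence I D \<Psi> X"
  using marginal_purity_le_1[OF assms]
  by (simp add: marginal_concurrence_def concurrence_def marginal_purity_def)

lemma marginal_concurrence_compl:
  assumes "X \<subseteq> I"
  shows "marginal_concurrence I D \<Psi> (I - X) = marginal_concurrence I D \<Psi> X"
  using marginal_purity_compl[OF assms, of D \<Psi>]
  by (simp add: marginal_concurrence_def concurrence_def marginal_purity_def)

lemma marginal_concurrence_subadditive:
  assumes fin: "finite I" "\<And>i. i \<in> I \<Longrightarrow> finite (D i)"
    and norm: "(\<Sum>f\<in>PiE I D. (cmod (\<Psi> f))\<^sup>2) = 1"
    and subset: "X \<subseteq> I" "Y \<subseteq> I"
  shows "marginal_concurrence I D \<Psi> (sym_diff X Y) \<le>
    marginal_concurrence I D \<Psi> X + marginal_concurrence I D \<Psi> Y"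
proof -
  let ?P = "marginal_purity I D \<Psi>"
  have "2 * (1 - ?P (sym_diff X Y)) \<le> 2 * (1 - ?P X) + 2 * (1 - ?P Y)"
    using marginal_purity_subadditive[OF subset, of D \<Psi>] norm by simp
  then have "sqrt (2 * (1 - ?P (sym_diff X Y))) \<le> sqrt (2 * (1 - ?P X) + 2 * (1 - ?P Y))"
    by (rule real_sqrt_le_mono)
  also have "\<dots> \<le> sqrt (2 * (1 - ?P X)) + sqrt (2 * (1 - ?P Y))"
    using marginal_purity_le_1[OF fin norm] subset by (intro sqrt_add_le_add_sqrt) auto
  finally show ?thesis by (simp add: marginal_concurrence_def concurrence_def marginal_purity_def)
qed

section \<open>Tripartite states\<close>

definition parties :: "nat set" where
  "parties = {0, 1, 2}"

lemma finite_parties [simp]: "finite parties"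
  by (simp add: parties_def)

lemma in_parties [simp]: "0 \<in> parties" "Suc 0 \<in> parties" "2 \<in> parties"
  by (simp_all add: parties_def)

definition levels :: "nat \<Rightarrow> nat \<Rightarrow> nat \<Rightarrow> nat set" where
  "levels dB dC k = {..<if k = 0 then 2 else if k = 1 then dB else dC}"

lemma finite_levels [simp]: "finite (levels dB dC k)"
  by (simp add: levels_def)

lemma enc_cong: "(\<And>k. k \<in> parties \<Longrightarrow> f k = g k) \<Longrightarrow> enc dB dC f = enc dB dC g"
  by (simp add: enc_def parties_def)

lemma enc_comp: "enc dB dC (\<lambda>k. comp dB dC k i) = i"
proof -
  have "i div (dB * dC) * dB + i div dC mod dB = i div dC"
    by (metis div_mult2_eq div_mult_mod_eq mult.commute)
  then have "enc dB dC (\<lambda>k. comp dB dC k i) = i div dC * dC + i mod dC"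
    by (simp add: enc_def comp_def flip: add_mult_distrib)
  then show ?thesis by simp
qed

lemma comp_in_levels:
  assumes "i < 2 * dB * dC" "k \<in> parties"
  shows "comp dB dC k i \<in> levels dB dC k"
proof -
  have "0 < dB" "0 < dC" using assms(1) by (cases "dB = 0"; cases "dC = 0"; simp)+
  then show ?thesis
    using assms by (auto simp: comp_def levels_def parties_def div_less_iff_less_mult mult.assoc)
qed

lemma comp_enc:
  assumes f_in: "f \<in> PiE parties (levels dB dC)" and "k \<in> parties"
  shows "comp dB dC k (enc dB dC f) = f k"
proof -
  have f1_less: "f 1 < dB" and f2_less: "f 2 < dC"
    using PiE_mem[OF f_in, of 1] PiE_mem[OF f_in, of 2] by (simp_all add: levels_def)
  have "enc dB dC f div dC = f 0 * dB + f 1"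
    using f2_less by (simp add: enc_def flip: add_mult_distrib)
  moreover have "enc dB dC f div (dB * dC) = enc dB dC f div dC div dB"
    using div_mult2_eq[of "enc dB dC f" dC dB] by (simp add: mult.commute)
  moreover have "enc dB dC f mod dC = f 2"
    using f2_less by (simp add: enc_def flip: add_mult_distrib)
  ultimately show ?thesis
    using assms(2) f1_less by (auto simp: comp_def parties_def)
qed

lemma enc_less:
  assumes f_in: "f \<in> PiE parties (levels dB dC)"
  shows "enc dB dC f < 2 * dB * dC"
proof -
  have "f 0 < 2" "f 1 < dB" "f 2 < dC"
    using PiE_mem[OF f_in, of 0] PiE_mem[OF f_in, of 1] PiE_mem[OF f_in, of 2]
    by (simp_all add: levels_def)
  moreover have "x * d + r < a * d" if "x < a" "r < d" for x a d r :: nat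
    using that mult_le_mono1[of "Suc x" a d] by simp
  ultimately have "(f 0 * dB + f 1) * dC + f 2 < 2 * dB * dC" by blast
  then show ?thesis by (simp add: enc_def add_mult_distrib)
qed

definition basis_labels :: "nat \<Rightarrow> nat \<Rightarrow> nat \<Rightarrow> nat \<Rightarrow> nat" where
  "basis_labels dB dC i = restrict (\<lambda>k. comp dB dC k i) parties"

lemma basis_labels_in_PiE: "i < 2 * dB * dC \<Longrightarrow> basis_labels dB dC i \<in> PiE parties (levels dB dC)"
  using comp_in_levels by (auto simp: basis_labels_def)

lemma enc_basis_labels: "enc dB dC (basis_labels dB dC i) = i"
proof -
  have "enc dB dC (basis_labels dB dC i) = enc dB dC (\<lambda>k. comp dB dC k i)"
    by (rule enc_cong) (simp add: basis_labels_def)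
  then show ?thesis by (simp add: enc_comp)
qed

lemma bij_betw_basis_labels:
  "bij_betw (basis_labels dB dC) {..<2 * dB * dC} (PiE parties (levels dB dC))"
proof (rule bij_betw_byWitness[where f' = "enc dB dC"])
  show "\<forall>f\<in>PiE parties (levels dB dC). basis_labels dB dC (enc dB dC f) = f"
  proof (intro ballI ext)
    fix f k assume f_in: "f \<in> PiE parties (levels dB dC)"
    show "basis_labels dB dC (enc dB dC f) k = f k"
      using comp_enc[OF f_in, of k] PiE_arb[OF f_in, of k]
      by (simp add: basis_labels_def restrict_def)
  qed
qed (simp_all add: image_subset_iff enc_basis_labels basis_labels_in_PiE enc_less)

definition amplitude :: "nat \<Rightarrow> nat \<Rightarrow> complex vec \<Rightarrow> (nat \<Rightarrow> nat) \<Rightarrow> complex" where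
  "amplitude dB dC \<psi> f = \<psi> $ enc dB dC f"

lemma sum_norm_amplitude:
  assumes "\<psi> \<in> carrier_vec (2 * dB * dC)"
  shows "(\<Sum>f\<in>PiE parties (levels dB dC). (cmod (amplitude dB dC \<psi> f))\<^sup>2) =
    (\<Sum>i<dim_vec \<psi>. (cmod (\<psi> $ i))\<^sup>2)"
  using assms
    sum.reindex_bij_betw[OF bij_betw_basis_labels, of "\<lambda>f. (cmod (amplitude dB dC \<psi> f))\<^sup>2" dB dC]
  by (simp add: amplitude_def enc_basis_labels)

lemma ptrans_proj:
  assumes carrier: "\<psi> \<in> carrier_vec (2 * dB * dC)" and subset: "X \<subseteq> parties"
  shows "ptrans dB dC X (proj \<psi>) = pure_ptrans (2 * dB * dC)
    (\<lambda>i. restrict (basis_labels dB dC i) X) (\<lambda>i. restrict (basis_labels dB dC i) (parties - X))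
    (split_amplitude X (amplitude dB dC \<psi>))"
proof -
  let ?N = "2 * dB * dC" and ?L = "basis_labels dB dC"
  define mix where
    "mix i j = enc dB dC (\<lambda>k. if k \<in> X then comp dB dC k j else comp dB dC k i)" for i j
  have mix_eq: "mix i j = enc dB dC (override_on (?L i) (?L j) X)" for i j
    unfolding mix_def by (rule enc_cong) (simp add: override_on_def basis_labels_def)
  have mix_less: "mix i j < ?N" if "i < ?N" "j < ?N" for i j
    unfolding mix_eq using basis_labels_in_PiE[OF that(1)] basis_labels_in_PiE[OF that(2)]
    by (intro enc_less) (auto simp: override_on_def PiE_iff extensional_def)
  have "\<psi> $ mix i j =
      split_amplitude X (amplitude dB dC \<psi>) (restrict (?L j) X) (restrict (?L i) (parties - X))"
    if "i < ?N" "j < ?N" for i j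
    using basis_labels_in_PiE[OF that(1)] basis_labels_in_PiE[OF that(2)]
      split_amplitude_restrict[OF subset, of "?L j" "levels dB dC" "?L i"]
    by (simp add: mix_eq amplitude_def)
  moreover have "ptrans dB dC X (proj \<psi>) = mat ?N ?N (\<lambda>(i, j). proj \<psi> $$ (mix i j, mix j i))"
    using carrier by (simp add: ptrans_def proj_def mix_def)
  ultimately show ?thesis
    using carrier by (auto simp: pure_ptrans_def proj_def mix_less)
qed

lemma bij_betw_bipartite_labels:
  assumes "X \<subseteq> parties"
  shows "bij_betw
    (\<lambda>i. (restrict (basis_labels dB dC i) X, restrict (basis_labels dB dC i) (parties - X)))
    {..<2 * dB * dC} (PiE X (levels dB dC) \<times> PiE (parties - X) (levels dB dC))"
  using bij_betw_trans[OF bij_betw_basis_labels bij_betw_restrict_PiE[OF assms]]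
  by (simp add: o_def)

locale tripartite_state =
  fixes dB dC :: nat and \<psi> :: "complex vec"
  assumes carrier: "\<psi> \<in> carrier_vec (2 * dB * dC)"
    and norm: "(\<Sum>i<dim_vec \<psi>. (cmod (\<psi> $ i))\<^sup>2) = 1"
begin

abbreviation conc :: "nat set \<Rightarrow> real" where
  "conc X \<equiv> marginal_concurrence parties (levels dB dC) (amplitude dB dC \<psi>) X"

lemma norm_amplitude: "(\<Sum>f\<in>PiE parties (levels dB dC). (cmod (amplitude dB dC \<psi> f))\<^sup>2) = 1"
  using norm by (simp only: sum_norm_amplitude[OF carrier])

lemma
  assumes subset: "X \<subseteq> parties"
  shows trace_norm_ptrans_ge: "1 + conc X \<le> trace_norm (ptrans dB dC X (proj \<psi>))"
    and trace_norm_ptrans_eq: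
      "card (PiE X (levels dB dC)) \<le> 2 \<Longrightarrow> trace_norm (ptrans dB dC X (proj \<psi>)) = 1 + conc X"
proof -
  let ?A = "PiE X (levels dB dC)" and ?B = "PiE (parties - X) (levels dB dC)"
  have fin: "finite ?A" "finite ?B" using subset by (auto intro!: finite_PiE intro: finite_subset)
  have norm_split: "(\<Sum>x\<in>?A. \<Sum>y\<in>?B. (cmod (split_amplitude X (amplitude dB dC \<psi>) x y))\<^sup>2) = 1"
    using norm_amplitude by (simp only: sum_norm_split_amplitude[OF subset])
  note unit_state = fin norm_split bij_betw_bipartite_labels[OF subset]
  show "1 + conc X \<le> trace_norm (ptrans dB dC X (proj \<psi>))"
    unfolding ptrans_proj[OF carrier subset] marginal_concurrence_def
    by (rule trace_norm_pure_ptrans_ge_concurrence[OF unit_state])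
  show "trace_norm (ptrans dB dC X (proj \<psi>)) = 1 + conc X" if "card ?A \<le> 2"
    unfolding ptrans_proj[OF carrier subset] marginal_concurrence_def
    by (rule trace_norm_pure_ptrans_eq_concurrence[OF unit_state that])
qed

lemma conc_nonneg: "X \<subseteq> parties \<Longrightarrow> 0 \<le> conc X"
  by (rule marginal_concurrence_nonneg) (simp_all add: norm_amplitude)

lemma conc_qubit_le: "conc {0} \<le> conc {0, 2} + conc {0, 1}"
proof -
  have "conc {0} = conc (parties - {0})"
    by (rule marginal_concurrence_compl[symmetric]) simp
  also have "parties - {0} = sym_diff {0, 2} {0, 1}" by (auto simp: parties_def)
  also have "conc \<dots> \<le> conc {0, 2} + conc {0, 1}"
    by (rule marginal_concurrence_subadditive) (simp_all add: norm_amplitude)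
  finally show ?thesis .
qed

end

theorem theorem2:
  fixes dB dC :: nat and \<psi> :: "complex vec"
  assumes "dB > 0" and "dC > 0"
    and "\<psi> \<in> carrier_vec (2 * dB * dC)"
    and "(\<Sum>i<dim_vec \<psi>. (cmod (\<psi> $ i))\<^sup>2) = 1"
  shows "log_neg dB dC {0} (proj \<psi>) - log_neg dB dC {0,2} (proj \<psi>)
           \<le> log_neg dB dC {0,1} (proj \<psi>)"
proof -
  interpret tripartite_state dB dC \<psi> using assms by unfold_locales
  let ?T = "\<lambda>X. trace_norm (ptrans dB dC X (proj \<psi>))"
  have nonneg: "0 \<le> conc {0}" "0 \<le> conc {0, 2}" "0 \<le> conc {0, 1}"
    by (simp_all add: conc_nonneg)
  have T_ge: "1 + conc {0, 2} \<le> ?T {0, 2}" "1 + conc {0, 1} \<le> ?T {0, 1}"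
    by (simp_all add: trace_norm_ptrans_ge)
  have T_qubit: "?T {0} = 1 + conc {0}"
    by (rule trace_norm_ptrans_eq) (simp_all add: card_PiE levels_def)
  also have "\<dots> \<le> (1 + conc {0, 2}) * (1 + conc {0, 1})"
    using conc_qubit_le mult_nonneg_nonneg[OF nonneg(2,3)] by (simp add: algebra_simps)
  also have "\<dots> \<le> ?T {0, 2} * ?T {0, 1}"
    using T_ge nonneg by (intro mult_mono) auto
  finally have "log 2 (?T {0}) \<le> log 2 (?T {0, 2} * ?T {0, 1})"
    using T_qubit nonneg(1) by (intro log_mono) auto
  moreover have "0 < ?T {0, 2}" "0 < ?T {0, 1}" using T_ge nonneg by linarith+
  ultimately show ?thesis by (simp add: log_neg_def log_mult)
qed

end
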